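(* Let $A,Q\in\mathrm{Sym}_+(d)$, $b\in\mathbb{R}^d$, and let $B_A$ be the system matrix of the linearization at equilibrium of the Stein gradient flow in the Gaussian submanifold, for the kernel $K(x,y)=x^{\mathrm T}Ay+1$ and target $\mathcal N(b,Q)$. 1. For $d=1$, the scaling $A>0$ minimizing the condition number of the system matrix $B_A$ is given by $$A=\frac{1}{2Q+b^2},$$ and the associated optimal step size is $h^*=Q>0$. If furthermore $b=0$, then (for this $A$) one obtains the continuous-time convergence rate $\|(\mu_t,\Sigma_t)\|\le e^{-\frac1Qt}\|(\mu_0,\Sigma_0)\|$ for solutions of the linearized system. 2. If $A$ and $Q$ are simultaneously diagonalizable and $\mu_0=b=0$, then the optimal $A$ (in the sense of minimizing the condition number of $B_A$ among such $A$) is $A=\frac12Q^{-1}$.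
   Context: $\mathrm{Sym}_+(d)$ is the set of real symmetric positive definite $d\times d$ matrices, $\mathrm{Sym}(M)=\frac12(M+M^{\mathrm T})$, $\otimes$ is the Kronecker product, and $M\oplus N:=M\otimes N+N\otimes M$. The Stein gradient flow of $\mathrm{KL}(\cdot\mid\mathcal N(b,Q))$ with kernel $K$ started at a Gaussian $\mathcal N(\mu_0,\Sigma_0)$ stays Gaussian $\mathcal N(\mu_t,\Sigma_t)$ with $$\dot\mu_t=(\mathrm{id}-Q^{-1}\Sigma_t)A\mu_t-K(\mu_t,\mu_t)Q^{-1}(\mu_t-b),$$ $$\dot\Sigma_t=2\,\mathrm{Sym}(\Sigma_tA)-2\,\mathrm{Sym}\big(\Sigma_tA(\Sigma_t+\mu_t(\mu_t-b)^{\mathrm T})Q^{-1}\big).$$ Its linearization at the equilibrium $(b,Q)$, with $(\mu,\Sigma)$ now denoting the perturbation from $(b,Q)$, is $$\dot\mu=-Q^{-1}(\Sigma Ab+K(b,b)\mu),\qquad \dot\Sigma=-2\,\mathrm{Sym}\big(QA(\Sigma+b\mu^{\mathrm T})Q^{-1}\big),$$ which is written as $\frac{d}{dt}(\mu,\mathrm{vec}(\Sigma))=-B_A(\mu,\mathrm{vec}(\Sigma))$ with system matrix $$B_A=\begin{pmatrix}K(b,b)Q^{-1}&(b^{\mathrm T}A)\otimes Q^{-1}\\(QAb)\oplus Q^{-1}&Q^{-1}\oplus(QA)\end{pmatrix}\in\mathbb{R}^{(d^2+d)\times(d^2+d)}.$$ The condition number of $B_A$ (which has positive eigenvalues in the cases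 considered) means $\lambda_{\max}(B_A)/\lambda_{\min}(B_A)$, the ratio of its largest to its smallest eigenvalue. The optimal step size $h^*$ for a given $A$ is the $h>0$ minimizing $\max_{\lambda\in\sigma(B_A)}|1-h\lambda|$, the asymptotic contraction factor of the explicit Euler iteration $x^k=(\mathrm{id}-hB_A)^kx^0$.
   Formalization: In part 2, "the optimal A is ½Q⁻¹" is proved as: ½Q⁻¹ attains the minimum; uniqueness is not claimed, since it fails for d ≥ 2, e.g. Q = diag(1,2), A = diag(1/2−e, 1/4) with small e > 0 also has condition number 2. *)

theory Defs
  imports "HOL-Analysis.Analysis"
begin

section \<open>Matrices\<close>

definition sym_pos :: "(real^'n^'n) set" where
  "sym_pos = {M. transpose M = M \<and> (\<forall>x. x \<noteq> 0 \<longrightarrow> 0 < x \<bullet> (M *v x))}"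

definition sym_part :: "real^'n^'n \<Rightarrow> real^'n^'n" where
  "sym_part M = (1/2) *\<^sub>R (M + transpose M)"

definition outer :: "real^'m \<Rightarrow> real^'n \<Rightarrow> real^'n^'m" where
  "outer x y = (\<chi> i j. x $ i * y $ j)"

definition diagonal :: "'a::zero^'n^'n \<Rightarrow> bool" where
  "diagonal M \<longleftrightarrow> (\<forall>i j. i \<noteq> j \<longrightarrow> M $ i $ j = 0)"

definition simultaneously_diagonalizable :: "real^'n^'n \<Rightarrow> real^'n^'n \<Rightarrow> bool" where
  "simultaneously_diagonalizable M N \<longleftrightarrow>
     (\<exists>P :: real^'n^'n. invertible P \<and> diagonal (matrix_inv P ** M ** P) \<and> diagonal (matrix_inv P ** N ** P))"

definition eigenvalues :: "'a::field^'n^'n \<Rightarrow> 'a set" where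
  "eigenvalues M = {l. \<exists>v. v \<noteq> 0 \<and> M *v v = l *s v}"

abbreviation complex_eigenvalues :: "real^'n^'n \<Rightarrow> complex set" where
  "complex_eigenvalues M \<equiv> eigenvalues (map_matrix complex_of_real M)"

text \<open>Every complex eigenvalue is real and positive.\<close>

definition positive_spectrum :: "real^'n^'n \<Rightarrow> bool" where
  "positive_spectrum M \<longleftrightarrow> complex_eigenvalues M \<subseteq> complex_of_real ` {0<..}"

text \<open>The quotient of the extreme eigenvalues (not of singular values). It is meant for
  matrices with \<^const>\<open>positive_spectrum\<close>, whose spectrum consists of the real eigenvalues.\<close>

definition condition_number :: "real^'n^'n \<Rightarrow> real" where
  "condition_number M = Max (eigenvalues M) / Min (eigenvalues M)"

definition contraction_factor :: "real^'n^'n \<Rightarrow> real \<Rightarrow> real" where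
  "contraction_factor M h = Max ((\<lambda>l. cmod (1 - complex_of_real h * l)) ` complex_eigenvalues M)"

definition optimal_step_size :: "real^'n^'n \<Rightarrow> real \<Rightarrow> bool" where
  "optimal_step_size M = is_arg_min (contraction_factor M) (\<lambda>h. 0 < h)"


section \<open>Kronecker products and block matrices\<close>

definition kron :: "real^'n^'m \<Rightarrow> real^'q^'p \<Rightarrow> real^('n \<times> 'q)^('m \<times> 'p)" (infixl "\<otimes>" 70) where
  "M \<otimes> N = (\<chi> i j. M $ fst i $ fst j * N $ snd i $ snd j)"

definition kron_sum :: "real^'n^'n \<Rightarrow> real^'n^'n \<Rightarrow> real^('n \<times> 'n)^('n \<times> 'n)" (infixl "\<oplus>" 65) where
  "M \<oplus> N = M \<otimes> N + N \<otimes> M"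

text \<open>A row or column vector as left or right factor produces index types \<open>1 \<times> 'n\<close> and
  \<open>'n \<times> 1\<close>, both of which are identified with \<open>'n\<close>.\<close>

definition row_kron :: "real^'n \<Rightarrow> real^'n^'n \<Rightarrow> real^('n \<times> 'n)^'n" where
  "row_kron x N = (\<chi> i j. ((rowvector x :: real^'n^1) \<otimes> N) $ (1, i) $ j)"

definition col_kron_sum :: "real^'n \<Rightarrow> real^'n^'n \<Rightarrow> real^'n^('n \<times> 'n)" where
  "col_kron_sum x N =
     (\<chi> i j. ((columnvector x :: real^1^'n) \<otimes> N) $ i $ (1, j)
           + (N \<otimes> (columnvector x :: real^1^'n)) $ i $ (j, 1))"

text \<open>Column stacking: the column index is the leading one, so that
  \<open>(M \<otimes> N) *v vectorize X = vectorize (N ** X ** transpose M)\<close>.\<close>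

definition vectorize :: "real^'n^'m \<Rightarrow> real^('n \<times> 'm)" where
  "vectorize X = (\<chi> p. X $ snd p $ fst p)"

definition stack :: "'a^'m \<Rightarrow> 'a^'n \<Rightarrow> 'a^('m + 'n)" where
  "stack x y = (\<chi> i. case i of Inl k \<Rightarrow> x $ k | Inr k \<Rightarrow> y $ k)"

definition block_matrix ::
  "'a^'n^'m \<Rightarrow> 'a^'q^'m \<Rightarrow> 'a^'n^'p \<Rightarrow> 'a^'q^'p \<Rightarrow> 'a^('n + 'q)^('m + 'p)" where
  "block_matrix M\<^sub>1\<^sub>1 M\<^sub>1\<^sub>2 M\<^sub>2\<^sub>1 M\<^sub>2\<^sub>2 =
     (\<chi> i. case i of Inl k \<Rightarrow> stack (M\<^sub>1\<^sub>1 $ k) (M\<^sub>1\<^sub>2 $ k) | Inr k \<Rightarrow> stack (M\<^sub>2\<^sub>1 $ k) (M\<^sub>2\<^sub>2 $ k))"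


section \<open>The Stein gradient flow on Gaussians\<close>

definition stein_kernel :: "real^'d^'d \<Rightarrow> real^'d \<Rightarrow> real^'d \<Rightarrow> real" where
  "stein_kernel A x y = x \<bullet> (A *v y) + 1"

text \<open>The vector field of the flow of \<open>(\<mu>, \<Sigma>)\<close> for the target with mean \<open>b\<close> and covariance \<open>Q\<close>.\<close>

definition stein_field ::
  "real^'d^'d \<Rightarrow> real^'d \<Rightarrow> real^'d^'d \<Rightarrow> (real^'d) \<times> (real^'d^'d) \<Rightarrow> (real^'d) \<times> (real^'d^'d)" where
  "stein_field Q b A = (\<lambda>(\<mu>, \<Sigma>).
     ((mat 1 - matrix_inv Q ** \<Sigma>) *v (A *v \<mu>)
        - stein_kernel A \<mu> \<mu> *\<^sub>R (matrix_inv Q *v (\<mu> - b)),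
      2 *\<^sub>R sym_part (\<Sigma> ** A)
        - 2 *\<^sub>R sym_part (\<Sigma> ** A ** (\<Sigma> + outer \<mu> (\<mu> - b)) ** matrix_inv Q)))"

text \<open>Here \<open>(\<mu>, \<Sigma>)\<close> is the perturbation from the equilibrium \<open>(b, Q)\<close>.\<close>

definition stein_linearization ::
  "real^'d^'d \<Rightarrow> real^'d \<Rightarrow> real^'d^'d \<Rightarrow> (real^'d) \<times> (real^'d^'d) \<Rightarrow> (real^'d) \<times> (real^'d^'d)" where
  "stein_linearization Q b A = (\<lambda>(\<mu>, \<Sigma>).
     (- (matrix_inv Q *v (\<Sigma> *v (A *v b) + stein_kernel A b b *\<^sub>R \<mu>)),
      - 2 *\<^sub>R sym_part (Q ** A ** (\<Sigma> + outer b \<mu>) ** matrix_inv Q)))"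

definition linearized_solution ::
  "real^'d^'d \<Rightarrow> real^'d \<Rightarrow> real^'d^'d \<Rightarrow> (real \<Rightarrow> real^'d) \<Rightarrow> (real \<Rightarrow> real^'d^'d) \<Rightarrow> bool" where
  "linearized_solution Q b A \<mu> \<Sigma> \<longleftrightarrow>
     (\<forall>t\<ge>0. ((\<lambda>s. (\<mu> s, \<Sigma> s)) has_vector_derivative stein_linearization Q b A (\<mu> t, \<Sigma> t))
        (at t within {0..}))"

definition system_matrix ::
  "real^'d^'d \<Rightarrow> real^'d \<Rightarrow> real^'d^'d \<Rightarrow> real^('d + 'd \<times> 'd)^('d + 'd \<times> 'd)" where
  "system_matrix Q b A =
     block_matrix
       (stein_kernel A b b *\<^sub>R matrix_inv Q)     (row_kron (b v* A) (matrix_inv Q))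
       (col_kron_sum (Q *v (A *v b)) (matrix_inv Q)) (matrix_inv Q \<oplus> (Q ** A))"


section \<open>The system matrix is that of the linearization of the field\<close>

lemma matrix_inv_sym_pos:
  fixes Q :: "real^'d^'d"
  assumes "Q \<in> sym_pos"
  shows "Q ** matrix_inv Q = mat 1" "matrix_inv Q ** Q = mat 1"
    "transpose (matrix_inv Q) = matrix_inv Q"
proof -
  have "\<forall>x. Q *v x = 0 \<longrightarrow> x = 0"
    using assms by (force simp: sym_pos_def)
  then have inv: "invertible Q"
    using invertible_left_inverse matrix_left_invertible_ker by blast
  then show 1: "Q ** matrix_inv Q = mat 1" and 2: "matrix_inv Q ** Q = mat 1"
    using someI_ex[of "\<lambda>R. Q ** R = mat 1 \<and> R ** Q = mat 1"]
    by (auto simp: matrix_inv_def invertible_def)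
  have "transpose (matrix_inv Q) ** transpose Q = mat 1"
    using 1 by (metis matrix_transpose_mul transpose_mat)
  then have "transpose (matrix_inv Q) ** Q = mat 1"
    using assms by (simp add: sym_pos_def)
  then show "transpose (matrix_inv Q) = matrix_inv Q"
    using 1 by (metis matrix_mul_assoc matrix_mul_lid matrix_mul_rid)
qed

lemma matrix_mult_has_derivative:
  fixes f :: "'x::real_normed_vector \<Rightarrow> real^'n^'m" and g :: "'x \<Rightarrow> real^'p^'n"
  assumes "(f has_derivative f') (at x)" "(g has_derivative g') (at x)"
  shows "((\<lambda>x. f x ** g x) has_derivative (\<lambda>h. f x ** g' h + f' h ** g x)) (at x)"
proof -
  have "bilinear ((**) :: real^'n^'m \<Rightarrow> real^'p^'n \<Rightarrow> real^'p^'m)"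
    unfolding bilinear_def
    by (auto intro!: linearI simp: matrix_matrix_mult_def vec_eq_iff sum.distrib algebra_simps
        sum_distrib_left)
  then show ?thesis
    unfolding bilinear_conv_bounded_bilinear by (rule bounded_bilinear.FDERIV[OF _ assms])
qed

lemma matrix_vector_has_derivative:
  fixes f :: "'x::real_normed_vector \<Rightarrow> real^'n^'m" and g :: "'x \<Rightarrow> real^'n"
  assumes "(f has_derivative f') (at x)" "(g has_derivative g') (at x)"
  shows "((\<lambda>x. f x *v g x) has_derivative (\<lambda>h. f x *v g' h + f' h *v g x)) (at x)"
proof -
  have "bilinear ((*v) :: real^'n^'m \<Rightarrow> real^'n \<Rightarrow> real^'m)"
    unfolding bilinear_def
    by (auto intro!: linearI simp: matrix_vector_mult_def vec_eq_iff sum.distrib algebra_simps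
        sum_distrib_left)
  then show ?thesis
    unfolding bilinear_conv_bounded_bilinear by (rule bounded_bilinear.FDERIV[OF _ assms])
qed

lemma outer_has_derivative:
  fixes f :: "'x::real_normed_vector \<Rightarrow> real^'m" and g :: "'x \<Rightarrow> real^'n"
  assumes "(f has_derivative f') (at x)" "(g has_derivative g') (at x)"
  shows "((\<lambda>x. outer (f x) (g x)) has_derivative (\<lambda>h. outer (f x) (g' h) + outer (f' h) (g x))) (at x)"
proof -
  have "bilinear (outer :: real^'m \<Rightarrow> real^'n \<Rightarrow> real^'n^'m)"
    unfolding bilinear_def
    by (auto intro!: linearI simp: outer_def vec_eq_iff algebra_simps)
  then show ?thesis
    unfolding bilinear_conv_bounded_bilinear by (rule bounded_bilinear.FDERIV[OF _ assms])
qed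

lemma sym_part_has_derivative:
  fixes f :: "'x::real_normed_vector \<Rightarrow> real^'n^'n"
  assumes "(f has_derivative f') (at x)"
  shows "((\<lambda>x. sym_part (f x)) has_derivative (\<lambda>h. sym_part (f' h))) (at x)"
proof -
  have "linear (sym_part :: real^'n^'n \<Rightarrow> real^'n^'n)"
    by (auto intro!: linearI simp: sym_part_def transpose_def vec_eq_iff algebra_simps)
  then show ?thesis
    unfolding linear_conv_bounded_linear by (rule bounded_linear.has_derivative[OF _ assms])
qed

lemma stein_field_has_derivative:
  fixes Q :: "real^'d^'d"
  assumes Q: "Q \<in> sym_pos"
  shows "(stein_field Q b A has_derivative stein_linearization Q b A) (at (b, Q))"
proof -
  let ?R = "matrix_inv Q"
  note inv = matrix_inv_sym_pos[OF Q]
  have f: "stein_field Q b A = (\<lambda>x.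
     ((mat 1 - ?R ** snd x) *v (A *v fst x) - (fst x \<bullet> (A *v fst x) + 1) *\<^sub>R (?R *v (fst x - b)),
      2 *\<^sub>R sym_part (snd x ** A)
        - 2 *\<^sub>R sym_part (snd x ** A ** (snd x + outer (fst x) (fst x - b)) ** ?R)))"
    by (auto simp: stein_field_def stein_kernel_def fun_eq_iff)
  have o0: "outer x 0 = 0" for x :: "real^'d"
    by (simp add: outer_def vec_eq_iff)
  have sp: "sym_part (M + N) = sym_part M + sym_part N" for M N :: "real^'d^'d"
    by (simp add: sym_part_def transpose_def vec_eq_iff field_simps)
  have c: "X ** Q ** ?R = X" for X :: "real^'d^'d"
    by (simp add: inv flip: matrix_mul_assoc)
  let ?z = "(b, Q)"
  have F: "(fst has_derivative fst) (at ?z)" and S: "(snd has_derivative snd) (at ?z)"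
    by (rule bounded_linear_imp_has_derivative bounded_linear_fst bounded_linear_snd)+
  have const: "((\<lambda>_. k) has_derivative (\<lambda>_. 0)) (at ?z)" for k :: "'x::real_normed_vector"
    by (rule has_derivative_const)
  note mm = matrix_mult_has_derivative and mv = matrix_vector_has_derivative
  note AF = mv[OF const[of A] F]
  note Fb = has_derivative_diff[OF F const[of b]]
  note m1 = mv[OF has_derivative_diff[OF const[of "mat 1"] mm[OF const[of ?R] S]] AF]
  note m2 = has_derivative_scaleR[OF has_derivative_add[OF has_derivative_inner[OF F AF] const[of 1]]
      mv[OF const[of ?R] Fb]]
  note SA = mm[OF S const[of A]]
  note s1 = has_derivative_scaleR_right[OF sym_part_has_derivative[OF SA], of 2]
  note s2 = has_derivative_scaleR_right[OF sym_part_has_derivative[OF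
      mm[OF mm[OF SA has_derivative_add[OF S outer_has_derivative[OF F Fb]]] const[of ?R]]], of 2]
  note D = has_derivative_Pair[OF has_derivative_diff[OF m1 m2] has_derivative_diff[OF s1 s2]]
  have z: "0 ** M = 0" "M ** 0 = 0" "0 *v x = 0" for M :: "real^'d^'d" and x :: "real^'d"
    by (simp_all add: vec_eq_iff matrix_matrix_mult_def matrix_vector_mult_def)
  have neg: "(- M) *v x = - (M *v x)" "(- M) ** N = - (M ** N)"
    for M N :: "real^'d^'d" and x :: "real^'d"
    by (simp_all add: vec_eq_iff matrix_vector_mult_def matrix_matrix_mult_def sum_negf)
  have radd: "(X + Y) ** ?R = X ** ?R + Y ** ?R" for X Y :: "real^'d^'d"
    by (simp add: vec_eq_iff matrix_matrix_mult_def sum.distrib algebra_simps)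
  show ?thesis
    unfolding f
    by (rule has_derivative_eq_rhs[OF D])
      (simp add: fun_eq_iff stein_linearization_def stein_kernel_def inv o0 c z neg radd sp
        scaleR_right_distrib matrix_vector_right_distrib matrix_vector_mult_scaleR
        matrix_vector_mul_assoc matrix_mul_assoc)
qed

lemma kron_mult_vectorize:
  "(M \<otimes> N) *v vectorize X = vectorize (N ** X ** transpose M)"
proof -
  have "((M \<otimes> N) *v vectorize X) $ (i, k) = vectorize (N ** X ** transpose M) $ (i, k)" for i k
  proof -
    have "((M \<otimes> N) *v vectorize X) $ (i, k) = (\<Sum>j\<in>UNIV. \<Sum>l\<in>UNIV. M $ i $ j * N $ k $ l * X $ l $ j)"
      by (simp add: matrix_vector_mult_def kron_def vectorize_def sum.cartesian_product case_prod_unfold)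
    also have "\<dots> = vectorize (N ** X ** transpose M) $ (i, k)"
      by (simp add: vectorize_def matrix_matrix_mult_def transpose_def sum_distrib_left mult_ac)
    finally show ?thesis .
  qed
  then show ?thesis by (auto simp: vec_eq_iff)
qed

lemma row_kron_mult_vectorize:
  fixes N :: "real^'n^'n"
  shows "row_kron x N *v vectorize X = N *v (X *v x)"
proof -
  have "(row_kron x N *v vectorize X) $ k = (\<Sum>j\<in>UNIV. \<Sum>l\<in>UNIV. x $ j * N $ k $ l * X $ l $ j)" for k
    by (simp add: matrix_vector_mult_def kron_def row_kron_def rowvector_def vectorize_def
        sum.cartesian_product case_prod_unfold)
  also have "\<dots>k = (N *v (X *v x)) $ k" for k
    by (subst sum.swap) (simp add: matrix_vector_mult_def sum_distrib_left mult_ac)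
  finally show ?thesis by (simp add: vec_eq_iff)
qed

lemma col_kron_sum_mult:
  fixes N :: "real^'n^'n"
  shows "col_kron_sum x N *v y = vectorize (outer (N *v y) x + outer x (N *v y))"
  by (auto simp: vec_eq_iff matrix_vector_mult_def kron_def col_kron_sum_def columnvector_def
      vectorize_def outer_def sum_distrib_left sum.distrib algebra_simps)

lemma block_matrix_mult_stack:
  fixes M :: "real^'n^'m" and N' :: "real^'q^'p"
  shows "block_matrix M N M' N' *v stack x y = stack (M *v x + N *v y) (M' *v x + N' *v y)"
proof -
  have "(\<Sum>i\<in>UNIV. f i) = (\<Sum>i\<in>UNIV. f (Inl i)) + (\<Sum>i\<in>UNIV. f (Inr i))" for f :: "'n + 'q \<Rightarrow> real"
    by (simp flip: UNIV_Plus_UNIV add: sum.Plus)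
  then show ?thesis
    by (auto simp: vec_eq_iff block_matrix_def stack_def matrix_vector_mult_def split: sum.split)
qed

lemma matrix_mult_outer: "M ** outer x y ** N = outer (M *v x) (transpose N *v y)"
  for M :: "real^'n^'m" and N :: "real^'p^'q"
  by (simp add: vec_eq_iff matrix_matrix_mult_def matrix_vector_mult_def outer_def transpose_def
      sum_distrib_left sum_distrib_right sum_product mult_ac)

lemma system_matrix_eq_linearization:
  fixes Q :: "real^'d^'d"
  assumes Q: "Q \<in> sym_pos" and A: "A \<in> sym_pos" and S: "transpose \<Sigma> = \<Sigma>"
  shows "system_matrix Q b A *v stack \<mu> (vectorize \<Sigma>) =
    - stack (fst (stein_linearization Q b A (\<mu>, \<Sigma>)))
            (vectorize (snd (stein_linearization Q b A (\<mu>, \<Sigma>))))"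
proof -
  define R where "R = matrix_inv Q"
  have R: "transpose R = R" using matrix_inv_sym_pos[OF Q] by (simp add: R_def)
  have TQ: "transpose Q = Q" and TA: "transpose A = A"
    using Q A by (auto simp: sym_pos_def)
  have bA: "b v* A = A *v b"
    using TA by (metis transpose_matrix_vector)
  have neg: "- stack x y = stack (- x) (- y)" for x :: "real^'d" and y :: "real^('d \<times> 'd)"
    by (simp add: vec_eq_iff stack_def split: sum.split)
  have vadd: "vectorize (X + Y) = vectorize X + vectorize Y" for X Y :: "real^'d^'d"
    by (simp add: vec_eq_iff vectorize_def)
  have vneg: "- vectorize X = vectorize (- X)" for X :: "real^'d^'d"
    by (simp add: vec_eq_iff vectorize_def)
  have outer_transpose: "transpose (outer x y) = outer y x" for x y :: "real^'d"
    by (simp add: vec_eq_iff outer_def transpose_def)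
  have 1: "stein_kernel A b b *\<^sub>R R *v \<mu> + R *v (\<Sigma> *v (A *v b))
      = R *v (\<Sigma> *v (A *v b) + stein_kernel A b b *\<^sub>R \<mu>)"
    by (simp add: scaleR_matrix_vector_assoc matrix_vector_right_distrib matrix_vector_mult_scaleR)
  have 2: "Q ** A ** (\<Sigma> + outer b \<mu>) ** R
      = Q ** A ** \<Sigma> ** R + outer (Q *v (A *v b)) (R *v \<mu>)" (is "?L = ?L1 + ?L2")
  proof -
    have "Q ** A ** (\<Sigma> + outer b \<mu>) = Q ** A ** \<Sigma> + Q ** A ** outer b \<mu>"
      by (rule matrix_add_ldistrib)
    moreover have "(X + Y) ** R = X ** R + Y ** R" for X Y :: "real^'d^'d"
      by (simp add: vec_eq_iff matrix_matrix_mult_def sum.distrib algebra_simps)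
    ultimately show ?thesis
      by (simp add: matrix_mult_outer R matrix_vector_mul_assoc)
  qed
  have 3: "transpose ?L1 = R ** \<Sigma> ** transpose (Q ** A)"
    by (simp add: matrix_transpose_mul R S matrix_mul_assoc)
  have tadd: "transpose (X + Y) = transpose X + transpose Y" for X Y :: "real^'d^'d"
    by (simp add: vec_eq_iff transpose_def)
  have 4: "2 *\<^sub>R sym_part ?L = (?L1 + transpose ?L1) + (?L2 + outer (R *v \<mu>) (Q *v (A *v b)))"
    by (simp add: sym_part_def 2 tadd outer_transpose)
  show ?thesis
    unfolding system_matrix_def R_def[symmetric] block_matrix_mult_stack bA row_kron_mult_vectorize
      col_kron_sum_mult kron_sum_def matrix_vector_mult_add_rdistrib kron_mult_vectorize
      stein_linearization_def prod.case fst_conv snd_conv neg vneg 1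
    by (simp add: 4 3 R vadd[symmetric] algebra_simps)
qed

end

theory Submission
  imports Defs
begin

text \<open>
  In dimension one the system matrix is a two-by-two matrix with real positive eigenvalues whose
  trace and determinant are explicit in the scaling \<open>a\<close>. With \<open>c = 2 q + b\<^sup>2\<close>, its condition number
  \<open>\<kappa>\<close> satisfies \<open>\<kappa> + 1 / \<kappa> + 2 = (a c + 1)\<^sup>2 / (2 a q)\<close> (lemma \<open>condition_number_dim_one\<close>), and
  the right-hand side has, for positive \<open>a\<close>, its only minimum where \<open>a c = 1\<close>. There the trace is \<open>2 / q\<close>. The best
  Euler step for two positive eigenvalues is two divided by their sum (lemma
  \<open>optimal_step_size_two_eigenvalues\<close>), which gives the step size \<open>q\<close>. If also \<open>b = 0\<close>, the
  linearization is minus the identity divided by \<open>q\<close>, and solutions decay exactly at that rate.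

  In arbitrary dimension with \<open>b = 0\<close>, a common eigenbasis \<open>p\<^sub>i\<close> of \<open>Q\<close> and \<open>A\<close> with eigenvalues
  \<open>q\<^sub>i\<close> and \<open>a\<^sub>i\<close> yields an eigenbasis of the system matrix: the vectors \<open>p\<^sub>i\<close> in the mean
  block with eigenvalues \<open>1 / q\<^sub>i\<close>, and their outer products in the covariance block with eigenvalues
  \<open>a\<^sub>j q\<^sub>j / q\<^sub>i + a\<^sub>i q\<^sub>i / q\<^sub>j\<close> (lemma \<open>system_matrix_eigenbasis\<close>). The numbers \<open>1 / q\<^sub>i\<close> are always
  present, so the condition number of the inverse of \<open>Q\<close> is a lower bound for every admissible
  \<open>A\<close>. Half the inverse of \<open>Q\<close> attains it, because all further eigenvalues are then means
  \<open>(1 / q\<^sub>i + 1 / q\<^sub>j) / 2\<close> (lemma \<open>half_inverse_attains_bound\<close>). It is admissible by the spectral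
  theorem for symmetric matrices, which is proved here by maximizing the Rayleigh quotient
  (lemma \<open>symmetric_matrix_eigenbasis\<close>).
\<close>

section \<open>Eigenbases\<close>

lemma column_matrix_mult: "column i (M ** N) = M *v column i N"
  by (simp add: column_def matrix_matrix_mult_def matrix_vector_mult_def vec_eq_iff)

lemma matrix_inv_invertible:
  fixes P :: "'a::field^'n^'n"
  assumes "invertible P"
  shows "P ** matrix_inv P = mat 1" "matrix_inv P ** P = mat 1"
  using assms someI_ex[of "\<lambda>R. P ** R = mat 1 \<and> R ** P = mat 1"]
  by (auto simp: matrix_inv_def invertible_def)

lemma column_invertible_nonzero:
  fixes P :: "'a::field^'n^'n"
  assumes "invertible P"
  shows "column i P \<noteq> 0"
proof
  assume "column i P = 0"
  then have "column i (matrix_inv P ** P) = 0"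
    by (simp add: column_matrix_mult)
  then have "column i (mat 1 :: 'a^'n^'n) $ i = 0"
    by (simp add: matrix_inv_invertible[OF assms])
  then show False
    by (simp add: column_def mat_def)
qed

lemma eigenvalues_of_eigenbasis:
  fixes M P :: "'a::field^'n^'n"
  assumes inv: "invertible P" and eig: "\<And>i. M *v column i P = l i *s column i P"
  shows "eigenvalues M = range l"
proof (intro set_eqI iffI)
  fix c assume "c \<in> range l"
  then show "c \<in> eigenvalues M"
    using eig column_invertible_nonzero[OF inv] by (auto simp: eigenvalues_def)
next
  fix c assume "c \<in> eigenvalues M"
  then obtain v where v: "v \<noteq> 0" "M *v v = c *s v"
    by (auto simp: eigenvalues_def)
  define u where "u = matrix_inv P *v v"
  have Pu: "v = P *v u"
    by (simp add: u_def matrix_vector_mul_assoc matrix_inv_invertible[OF inv])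
  define w where "w = (\<chi> i. l i * u $ i)"
  have "M *v v = (\<Sum>i\<in>UNIV. u $ i *s (M *v column i P))"
    unfolding Pu matrix_mult_sum[of P]
    by (simp add: vec.linear_sum[OF matrix_vector_mul_linear_gen]
        vec.linear_scale[OF matrix_vector_mul_linear_gen])
  also have "\<dots> = P *v w"
    by (simp only: eig matrix_mult_sum[of P] w_def vec_lambda_beta vector_smult_assoc mult.commute)
  also have "M *v v = P *v (c *s u)"
    by (simp only: v(2) vec.linear_scale[OF matrix_vector_mul_linear_gen] flip: Pu)
  finally have "matrix_inv P *v (P *v (c *s u)) = matrix_inv P *v (P *v w)"
    by simp
  then have "c *s u = w"
    by (simp add: matrix_vector_mul_assoc matrix_inv_invertible[OF inv])
  moreover have "u \<noteq> 0"
    using v(1) Pu by auto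
  then obtain i where "u $ i \<noteq> 0"
    by (auto simp: vec_eq_iff)
  ultimately show "c \<in> range l"
    by (force simp: vec_eq_iff w_def)
qed

text \<open>A real eigenbasis stays an eigenbasis over the complex numbers, so it accounts for all complex
  eigenvalues and they are real. Positivity of the whole complex spectrum is obtained this way.\<close>

lemma complex_eigenvalues_of_eigenbasis:
  fixes M P :: "real^'n^'n"
  assumes inv: "invertible P" and eig: "\<And>i. M *v column i P = l i *s column i P"
  shows "complex_eigenvalues M = complex_of_real ` range l"
proof -
  have mult: "map_matrix complex_of_real (X ** Y) = map_matrix complex_of_real X ** map_matrix complex_of_real Y"
    for X Y :: "real^'n^'n"
    by (simp add: vec_eq_iff matrix_matrix_mult_def)
  have "map_matrix complex_of_real (matrix_inv P ** P) = map_matrix complex_of_real (mat 1)"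
    by (simp add: matrix_inv_invertible[OF inv])
  moreover have "map_matrix complex_of_real (mat 1) = (mat 1 :: complex^'n^'n)"
    by (simp add: vec_eq_iff mat_def)
  ultimately have "invertible (map_matrix complex_of_real P)"
    by (metis mult invertible_left_inverse)
  moreover have "map_matrix complex_of_real M *v column i (map_matrix complex_of_real P)
      = complex_of_real (l i) *s column i (map_matrix complex_of_real P)" for i
  proof -
    have "(M *v column i P) $ k = (l i *s column i P) $ k" for k
      by (simp add: eig)
    then have "complex_of_real ((M *v column i P) $ k) = complex_of_real ((l i *s column i P) $ k)" for k
      by simp
    then show ?thesis
      by (simp add: vec_eq_iff matrix_vector_mult_def column_def)
  qed
  ultimately show ?thesis
    by (subst eigenvalues_of_eigenbasis) auto
qed

text \<open>Simultaneous diagonalizability speaks of conjugates of a matrix; everything below uses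
  the columns of the conjugating matrix, which are its eigenvectors.\<close>

lemma diagonal_iff_eigenbasis:
  fixes M P :: "'a::field^'n^'n"
  assumes inv: "invertible P"
  shows "diagonal (matrix_inv P ** M ** P) \<longleftrightarrow> (\<exists>l. \<forall>i. M *v column i P = l i *s column i P)"
proof
  assume D: "diagonal (matrix_inv P ** M ** P)" (is "diagonal ?D")
  have "M *v column i P = ?D $ i $ i *s column i P" for i
  proof -
    have "M *v column i P = column i (P ** ?D)"
      by (simp add: matrix_mul_assoc matrix_inv_invertible[OF inv] column_matrix_mult)
    also have "\<dots> = (\<Sum>j\<in>UNIV. ?D $ j $ i *s column j P)"
      unfolding column_matrix_mult[of i P] matrix_mult_sum[of P] by (simp add: column_def)
    also have "\<dots> = (\<Sum>j\<in>UNIV. if j = i then ?D $ i $ i *s column i P else 0)"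
      using D by (intro sum.cong) (auto simp: diagonal_def)
    finally show ?thesis by simp
  qed
  then show "\<exists>l. \<forall>i. M *v column i P = l i *s column i P"
    by (intro exI[of _ "\<lambda>i. ?D $ i $ i"]) blast
next
  assume "\<exists>l. \<forall>i. M *v column i P = l i *s column i P"
  then obtain l where l: "M *v column i P = l i *s column i P" for i by blast
  have "(matrix_inv P ** M ** P) $ j $ i = l i * mat 1 $ j $ i" for i j
  proof -
    have "column i (matrix_inv P ** M ** P) = matrix_inv P *v (l i *s column i P)"
      by (simp add: column_matrix_mult l flip: matrix_mul_assoc)
    also have "\<dots> = l i *s column i (matrix_inv P ** P)"
      by (simp add: column_matrix_mult vec.linear_scale[OF matrix_vector_mul_linear_gen])
    finally show ?thesis
      by (simp add: matrix_inv_invertible[OF inv] column_def vec_eq_iff)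
  qed
  then show "diagonal (matrix_inv P ** M ** P)"
    by (simp add: diagonal_def mat_def)
qed

section \<open>Diagonalization of symmetric matrices\<close>

text \<open>Near zero the linear term dominates the quadratic one and would take both signs.\<close>

lemma nonneg_parabola_linear_coeff_zero:
  fixes c d :: real
  assumes "\<And>t. 0 \<le> 2 * t * c + t\<^sup>2 * d"
  shows "c = 0"
proof (rule ccontr)
  assume c: "c \<noteq> 0"
  have "d \<ge> 0"
    using assms[of 1] assms[of "-1"] by simp
  \<comment> \<open>The shift by one avoids a vanishing denominator; for \<open>d > 0\<close> the minimizer is \<open>- c / d\<close>.\<close>
  have "2 * (- c / (d + 1)) * c + (- c / (d + 1))\<^sup>2 * d = - (c\<^sup>2 * (d + 2) / (d + 1)\<^sup>2)"
  proof -
    have "d + 1 \<noteq> 0"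
      using \<open>d \<ge> 0\<close> by simp
    then show ?thesis
      by (simp add: divide_simps) algebra
  qed
  moreover have "0 < c\<^sup>2 * (d + 2) / (d + 1)\<^sup>2"
    using \<open>d \<ge> 0\<close> c by simp
  ultimately show False
    using assms[of "- c / (d + 1)"] by linarith
qed

text \<open>The maximizer \<open>v\<close> of the Rayleigh quotient, with maximum \<open>l\<close>, is an eigenvector: the form
  of \<open>l - T\<close> is nonnegative on \<open>S\<close> and vanishes at \<open>v\<close>, so its first variation at \<open>v\<close> is zero,
  and testing with \<open>l v - T v\<close> itself shows that this vector is zero.\<close>

lemma selfadjoint_eigenvector:
  fixes T :: "'a::euclidean_space \<Rightarrow> 'a"
  assumes T: "linear T" and sa: "\<And>x y. x \<bullet> T y = T x \<bullet> y"
    and S: "subspace S" "S \<noteq> {0}" and inv: "T ` S \<subseteq> S"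
  obtains l v where "v \<in> S" "norm v = 1" "T v = l *\<^sub>R v"
proof -
  have cont: "continuous_on X T" for X
    using T by (simp add: linear_continuous_on linear_conv_bounded_linear)
  obtain x where "x \<in> S" "x \<noteq> 0"
    using S subspace_0 by blast
  then have "x /\<^sub>R norm x \<in> S \<inter> sphere 0 1"
    using S by (simp add: subspace_scale)
  then have "S \<inter> sphere 0 1 \<noteq> {}"
    by blast
  moreover have "compact (S \<inter> sphere 0 1)"
    using S(1) closed_subspace by (intro closed_Int_compact) auto
  moreover have "continuous_on (S \<inter> sphere 0 1) (\<lambda>x. x \<bullet> T x)"
    by (intro continuous_on_inner continuous_on_id cont)
  ultimately obtain v where v: "v \<in> S \<inter> sphere 0 1"
    and max: "\<And>y. y \<in> S \<inter> sphere 0 1 \<Longrightarrow> y \<bullet> T y \<le> v \<bullet> T v"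
    using continuous_attains_sup[of "S \<inter> sphere 0 1" "\<lambda>x. x \<bullet> T x"]
    by blast
  define l where "l = v \<bullet> T v"
  define N where "N = (\<lambda>x. l *\<^sub>R x - T x)"
  have nonneg: "0 \<le> y \<bullet> N y" if "y \<in> S" for y
  proof (cases "y = 0")
    case False
    then have "(y /\<^sub>R norm y) \<bullet> T (y /\<^sub>R norm y) \<le> l"
      unfolding l_def using that S by (intro max) (simp add: subspace_scale)
    then have "(y \<bullet> T y) / (norm y)\<^sup>2 \<le> l"
      by (simp add: linear_cmul[OF T] field_simps power2_eq_square)
    then show ?thesis
      using False by (simp add: N_def inner_diff_right divide_le_eq dot_square_norm)
  qed simp
  have vv: "v \<bullet> v = 1"
    using v by (simp add: norm_eq_1)
  have "w \<bullet> N v = 0" if w: "w \<in> S" for w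
  proof (rule nonneg_parabola_linear_coeff_zero)
    fix t
    have "v + t *\<^sub>R w \<in> S"
      using v w S by (auto intro: subspace_add subspace_scale)
    moreover have "(v + t *\<^sub>R w) \<bullet> N (v + t *\<^sub>R w) = 2 * t * (w \<bullet> N v) + t\<^sup>2 * (w \<bullet> N w)"
      using vv sa[of v w]
      by (simp add: N_def linear_add[OF T] linear_cmul[OF T] l_def inner_simps algebra_simps
          power2_eq_square inner_commute)
    ultimately show "0 \<le> 2 * t * (w \<bullet> N v) + t\<^sup>2 * (w \<bullet> N w)"
      using nonneg by metis
  qed
  moreover have "N v \<in> S"
    using v S inv by (auto simp: N_def intro!: subspace_diff subspace_scale)
  ultimately have "N v = 0"
    using inner_eq_zero_iff by blast
  with v that[of v l] show ?thesis
    by (auto simp: N_def)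
qed

text \<open>Split off one eigenvector; its orthogonal complement in \<open>S\<close> is again invariant because \<open>T\<close> is
  self-adjoint.\<close>

lemma selfadjoint_eigenbasis_on_subspace:
  fixes T :: "'a::euclidean_space \<Rightarrow> 'a"
  assumes T: "linear T" and sa: "\<And>x y. x \<bullet> T y = T x \<bullet> y"
  shows "subspace S \<Longrightarrow> T ` S \<subseteq> S \<Longrightarrow>
    \<exists>B. independent B \<and> span B = S \<and> (\<forall>v\<in>B. \<exists>l. T v = l *\<^sub>R v)"
proof (induction "dim S" arbitrary: S rule: less_induct)
  case less
  show ?case
  proof (cases "S = {0}")
    case True
    then show ?thesis
      by (intro exI[of _ "{}"]) (simp add: independent_empty)
  next
    case False
    with less.prems obtain l v where v: "v \<in> S" "norm v = 1" "T v = l *\<^sub>R v"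
      using selfadjoint_eigenvector[OF T sa, of S] by metis
    have vv: "v \<bullet> v = 1"
      using v by (simp add: norm_eq_1)
    define S' where "S' = S \<inter> {x. v \<bullet> x = 0}"
    have S': "subspace S'"
      unfolding S'_def by (rule subspace_inter[OF less.prems(1) subspace_hyperplane])
    have TS': "T ` S' \<subseteq> S'"
      using less.prems sa[of v] v(3) by (auto simp: S'_def)
    have "v \<notin> S'"
      using vv by (simp add: S'_def)
    then have "S' \<subset> S"
      using v(1) unfolding S'_def by blast
    then have "dim S' < dim S"
      using S' less.prems(1) by (intro dim_psubset) (simp only: span_eq_iff[THEN iffD2])
    then obtain B where B: "independent B" "span B = S'" "\<forall>v\<in>B. \<exists>l. T v = l *\<^sub>R v"
      using less.hyps S' TS' by blast
    have "span (insert v B) = S"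
    proof
      show "span (insert v B) \<subseteq> S"
        using v(1) B(2) less.prems(1) by (intro span_minimal) (auto simp: S'_def intro: span_base)
      show "S \<subseteq> span (insert v B)"
      proof
        fix x assume "x \<in> S"
        then have "x - (v \<bullet> x) *\<^sub>R v \<in> S'"
          using v(1) vv less.prems(1) by (auto simp: S'_def inner_simps intro!: subspace_diff subspace_scale)
        then show "x \<in> span (insert v B)"
          using B(2) by (auto simp: span_insert)
      qed
    qed
    moreover have "independent (insert v B)"
      using B \<open>v \<notin> S'\<close> by (simp add: independent_insertI)
    ultimately show ?thesis
      using B(3) v(3) by blast
  qed
qed

lemma symmetric_matrix_eigenbasis:
  fixes M :: "real^'n^'n"
  assumes "transpose M = M"
  obtains P :: "real^'n^'n" and l where "invertible P" "\<And>i. M *v column i P = l i *s column i P"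
proof -
  have "x \<bullet> (M *v y) = (M *v x) \<bullet> y" for x y
    by (metis assms dot_lmul_matrix transpose_matrix_vector)
  then obtain B where B: "independent B" "span B = UNIV" "\<forall>v\<in>B. \<exists>l. M *v v = l *\<^sub>R v"
    using selfadjoint_eigenbasis_on_subspace[of "(*v) M" UNIV] by auto
  have "finite B"
    using B(1) independent_imp_finite by blast
  moreover have "card B = CARD('n)"
    using B by (metis dim_UNIV dim_span_eq_card_independent DIM_cart DIM_real mult.right_neutral)
  ultimately obtain f where f: "bij_betw f (UNIV :: 'n set) B"
    using finite_same_card_bij[of "UNIV :: 'n set" B] by auto
  define P :: "real^'n^'n" where "P = (\<chi> i j. f j $ i)"
  have col: "column j P = f j" for j
    by (simp add: P_def column_def vec_eq_iff)
  have "columns P = B"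
    using f by (auto simp: columns_def col bij_betw_def)
  then have "invertible P"
    using B(2) by (simp add: invertible_right_inverse matrix_right_invertible_span_columns span_vec_eq)
  moreover have "\<forall>i. \<exists>l. M *v column i P = l *s column i P"
    using B(3) f by (auto simp: col bij_betw_def scalar_mult_eq_scaleR)
  ultimately show ?thesis
    using that by metis
qed

section \<open>Positive definite matrices\<close>

lemma sym_pos_eigenvalue_pos:
  assumes M: "M \<in> sym_pos" and v: "v \<noteq> 0" "M *v v = l *s v"
  shows "0 < l"
proof -
  have "0 < v \<bullet> (M *v v)"
    using M v(1) by (simp add: sym_pos_def)
  also have "\<dots> = l * (v \<bullet> v)"
    by (simp add: v(2) scalar_mult_eq_scaleR)
  finally show ?thesis
    by (rule zero_less_mult_pos2) (simp add: v(1))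
qed

lemma sym_pos_invertible: "Q \<in> sym_pos \<Longrightarrow> invertible Q"
  using matrix_inv_sym_pos invertible_right_inverse by blast

lemma sym_pos_matrix_inv:
  assumes Q: "Q \<in> sym_pos"
  shows "matrix_inv Q \<in> sym_pos"
proof -
  have "0 < x \<bullet> (matrix_inv Q *v x)" if "x \<noteq> 0" for x
  proof -
    define y where "y = matrix_inv Q *v x"
    have x: "x = Q *v y"
      by (simp add: y_def matrix_vector_mul_assoc matrix_inv_sym_pos[OF Q])
    with that have "y \<noteq> 0" by auto
    then have "0 < y \<bullet> (Q *v y)"
      using Q by (simp add: sym_pos_def)
    then show ?thesis
      by (simp add: x[symmetric] y_def[symmetric] inner_commute)
  qed
  then show ?thesis
    by (simp add: sym_pos_def matrix_inv_sym_pos[OF Q])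
qed

lemma sym_pos_scaleR: "M \<in> sym_pos \<Longrightarrow> 0 < c \<Longrightarrow> c *\<^sub>R M \<in> sym_pos"
  by (auto simp: sym_pos_def transpose_scalar scaleR_matrix_vector_assoc[symmetric])

lemma matrix_inv_eigenvector:
  fixes Q :: "'a::field^'n^'n"
  assumes Q: "invertible Q" and v: "Q *v v = l *s v" and l: "l \<noteq> 0"
  shows "matrix_inv Q *v v = (1 / l) *s v"
proof -
  have "v = matrix_inv Q *v (l *s v)"
    by (simp add: matrix_vector_mul_assoc matrix_inv_invertible[OF Q] flip: v)
  also have "\<dots> = l *s (matrix_inv Q *v v)"
    by (simp only: vec.linear_scale[OF matrix_vector_mul_linear_gen])
  finally show ?thesis
    using l by (metis vector_smult_assoc vector_smult_lid nonzero_divide_eq_eq)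
qed

section \<open>The spectrum of the system matrix at zero mean\<close>

lemma kron_mult: "(M \<otimes> N) ** (M' \<otimes> N') = (M ** M') \<otimes> (N ** N')"
proof -
  have "((M \<otimes> N) ** (M' \<otimes> N')) $ i $ j = ((M ** M') \<otimes> (N ** N')) $ i $ j" for i j
    by (simp add: matrix_matrix_mult_def kron_def sum_product sum.cartesian_product case_prod_unfold mult_ac flip: UNIV_Times_UNIV)
  then show ?thesis by (simp add: vec_eq_iff)
qed

lemma kron_mat_1: "(mat 1 :: real^'n^'n) \<otimes> (mat 1 :: real^'m^'m) = mat 1"
  by (auto simp: kron_def mat_def vec_eq_iff)

lemma invertible_kron:
  assumes "invertible (M :: real^'n^'n)" "invertible (N :: real^'m^'m)"
  shows "invertible (M \<otimes> N)"
  using assms by (metis invertible_right_inverse kron_mult kron_mat_1)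

lemma stack_eq_iff: "stack x y = stack x' y' \<longleftrightarrow> x = x' \<and> y = y'"
  by (auto simp: stack_def vec_eq_iff split: sum.splits)

lemma stack_surj: "\<exists>x y. z = stack x y"
  by (rule exI[of _ "\<chi> i. z $ Inl i"], rule exI[of _ "\<chi> i. z $ Inr i"])
    (auto simp: stack_def vec_eq_iff split: sum.splits)

lemma stack_0: "stack 0 0 = 0"
  by (auto simp: stack_def vec_eq_iff split: sum.splits)

lemma stack_scale: "c *s stack x y = stack (c *s x) (c *s y)"
  by (auto simp: stack_def vec_eq_iff split: sum.splits)

lemma invertible_block_diagonal:
  fixes M :: "real^'n^'n" and N :: "real^'m^'m"
  assumes "invertible M" "invertible N"
  shows "invertible (block_matrix M 0 0 N)"
proof -
  have "z = 0" if z: "block_matrix M 0 0 N *v z = 0" for z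
  proof -
    obtain x y where "z = stack x y"
      using stack_surj by blast
    with z have "M *v x = 0" "N *v y = 0"
      by (simp_all add: block_matrix_mult_stack stack_eq_iff flip: stack_0)
    then have "x = 0" "y = 0"
      using assms by (metis invertible_left_inverse matrix_left_invertible_ker)+
    then show ?thesis
      by (simp add: \<open>z = stack x y\<close> stack_0)
  qed
  then show ?thesis
    using invertible_left_inverse matrix_left_invertible_ker by blast
qed

text \<open>The eigenvalues at zero mean, for a common eigenbasis of \<open>Q\<close> and \<open>A\<close> with eigenvalues \<open>q\<close> and
  \<open>a\<close>: the mean block contributes one for each basis vector, the covariance block one for each
  ordered pair of them.\<close>

definition zero_mean_eigenvalue :: "('d \<Rightarrow> real) \<Rightarrow> ('d \<Rightarrow> real) \<Rightarrow> 'd + 'd \<times> 'd \<Rightarrow> real" where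
  "zero_mean_eigenvalue q a k = (case k of Inl i \<Rightarrow> 1 / q i
     | Inr (i, j) \<Rightarrow> a j * q j / q i + a i * q i / q j)"

lemma outer_scale: "outer (c *s x) (d *s y) = (c * d) *\<^sub>R outer x y"
  by (simp add: outer_def vec_eq_iff)

text \<open>At zero mean the off-diagonal blocks vanish. The mean block is the inverse of \<open>Q\<close>, and the
  covariance block maps an outer product of common eigenvectors of \<open>Q\<close> and \<open>A\<close> to a multiple of
  itself. Under column stacking these outer products are the columns of \<open>P \<otimes> P\<close>.\<close>

lemma system_matrix_eigenbasis:
  fixes Q A P :: "real^'d^'d"
  assumes Q: "invertible Q" and P: "invertible P"
    and q: "\<And>i. Q *v column i P = q i *s column i P" "\<And>i. q i \<noteq> 0"
    and a: "\<And>i. A *v column i P = a i *s column i P"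
  defines "S \<equiv> block_matrix P 0 0 (P \<otimes> P)"
  shows "invertible S"
    and "system_matrix Q 0 A *v column k S = zero_mean_eigenvalue q a k *s column k S"
proof -
  show "invertible S"
    unfolding S_def by (intro invertible_block_diagonal invertible_kron P)
  let ?p = "\<lambda>i. column i P" and ?R = "matrix_inv Q"
  have R: "?R *v ?p i = (1 / q i) *s ?p i" for i
    by (intro matrix_inv_eigenvector Q q)
  have QA: "(Q ** A) *v ?p i = (a i * q i) *s ?p i" for i
    by (simp add: a q vec.linear_scale[OF matrix_vector_mul_linear_gen]
        flip: matrix_vector_mul_assoc)
  have system: "system_matrix Q 0 A = block_matrix ?R 0 0 (?R \<oplus> (Q ** A))"
    by (simp add: system_matrix_def stein_kernel_def row_kron_def col_kron_sum_def kron_def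
        rowvector_def columnvector_def vec_eq_iff block_matrix_def stack_def split: sum.splits)
  have kron: "(M \<otimes> N) *v vectorize (outer y x) = vectorize (outer (N *v y) (M *v x))"
    for M N :: "real^'d^'d" and x y
    by (simp add: kron_mult_vectorize matrix_mult_outer)
  show "system_matrix Q 0 A *v column k S = zero_mean_eigenvalue q a k *s column k S"
  proof (cases k)
    case (Inl i)
    have col: "column k S = stack (?p i) 0"
      by (auto simp: S_def Inl column_def block_matrix_def stack_def vec_eq_iff split: sum.splits)
    show ?thesis
      unfolding col system block_matrix_mult_stack R stack_scale by (simp add: Inl zero_mean_eigenvalue_def)
  next
    case (Inr ij)
    obtain i j where ij: "ij = (i, j)" by (cases ij)
    have col: "column k S = stack 0 (vectorize (outer (?p j) (?p i)))"
      by (auto simp: S_def Inr ij column_def block_matrix_def stack_def vec_eq_iff kron_def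
          vectorize_def outer_def split: sum.splits)
    have "(?R \<oplus> (Q ** A)) *v vectorize (outer (?p j) (?p i))
        = zero_mean_eigenvalue q a k *s vectorize (outer (?p j) (?p i))"
      unfolding kron_sum_def matrix_vector_mult_add_rdistrib kron R QA outer_scale
      by (simp add: Inr ij zero_mean_eigenvalue_def vectorize_def vec_eq_iff algebra_simps)
    then show ?thesis
      unfolding col system block_matrix_mult_stack stack_scale by simp
  qed
qed

lemma simultaneously_diagonalizable_eigenbasis:
  assumes "simultaneously_diagonalizable M N"
  obtains P :: "real^'n^'n" and l m where "invertible P"
    "\<And>i. M *v column i P = l i *s column i P" "\<And>i. N *v column i P = m i *s column i P"
  using assms unfolding simultaneously_diagonalizable_def by (metis diagonal_iff_eigenbasis)

lemma system_matrix_spectrum: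
  fixes Q A P :: "real^'d^'d"
  assumes Q: "Q \<in> sym_pos" and A: "A \<in> sym_pos" and P: "invertible P"
    and q: "\<And>i. Q *v column i P = q i *s column i P"
    and a: "\<And>i. A *v column i P = a i *s column i P"
  shows "eigenvalues (matrix_inv Q) = range (\<lambda>i. 1 / q i)"
    and "eigenvalues (system_matrix Q 0 A) = range (zero_mean_eigenvalue q a)"
    and "complex_eigenvalues (system_matrix Q 0 A) = complex_of_real ` range (zero_mean_eigenvalue q a)"
    and "0 < q i" and "0 < zero_mean_eigenvalue q a k"
proof -
  have qpos: "0 < q i" and apos: "0 < a i" for i
    using sym_pos_eigenvalue_pos Q A q a column_invertible_nonzero[OF P] by blast+
  then show "0 < q i" by blast
  show "0 < zero_mean_eigenvalue q a k"
    using qpos apos by (auto simp: zero_mean_eigenvalue_def intro!: add_pos_pos split: sum.split)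
  have q0: "q i \<noteq> 0" for i
    using qpos[of i] by simp
  show "eigenvalues (matrix_inv Q) = range (\<lambda>i. 1 / q i)"
    using matrix_inv_eigenvector[OF sym_pos_invertible[OF Q] q q0]
    by (rule eigenvalues_of_eigenbasis[OF P])
  note S = system_matrix_eigenbasis[OF sym_pos_invertible[OF Q] P q q0 a]
  show "eigenvalues (system_matrix Q 0 A) = range (zero_mean_eigenvalue q a)"
    by (rule eigenvalues_of_eigenbasis[OF S])
  show "complex_eigenvalues (system_matrix Q 0 A) = complex_of_real ` range (zero_mean_eigenvalue q a)"
    by (rule complex_eigenvalues_of_eigenbasis[OF S])
qed

section \<open>The condition number at zero mean\<close>

lemma condition_number_mono:
  fixes M :: "real^'n^'n" and N :: "real^'m^'m"
  assumes "eigenvalues M \<subseteq> eigenvalues N" "eigenvalues M \<noteq> {}" "finite (eigenvalues N)"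
    "eigenvalues N \<subseteq> {0<..}"
  shows "condition_number M \<le> condition_number N"
proof -
  have "Min (eigenvalues N) \<in> eigenvalues N" "Max (eigenvalues M) \<in> eigenvalues N"
    using assms Max_in[OF finite_subset[OF assms(1,3)]] Min_in[OF assms(3)] by blast+
  then have "0 < Min (eigenvalues N)" "0 < Max (eigenvalues M)"
    using assms(4) by auto
  moreover have "Max (eigenvalues M) \<le> Max (eigenvalues N)"
    by (rule Max_mono[OF assms(1-3)])
  moreover have "Min (eigenvalues N) \<le> Min (eigenvalues M)"
    by (rule Min_antimono[OF assms(1-3)])
  ultimately show ?thesis
    unfolding condition_number_def by (intro frac_le) auto
qed

lemma condition_number_sandwich:
  fixes M :: "real^'n^'n" and N :: "real^'m^'m"
  assumes "eigenvalues M \<subseteq> eigenvalues N" "eigenvalues M \<noteq> {}" "finite (eigenvalues N)"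
    "\<And>l. l \<in> eigenvalues N \<Longrightarrow> \<exists>x\<in>eigenvalues M. \<exists>y\<in>eigenvalues M. x \<le> l \<and> l \<le> y"
  shows "condition_number N = condition_number M"
proof -
  have fin: "finite (eigenvalues M)" and ne: "eigenvalues N \<noteq> {}"
    using assms finite_subset by blast+
  have "Max (eigenvalues N) \<le> Max (eigenvalues M)"
    using assms(4)[OF Max_in[OF assms(3) ne]] by (meson Max_ge fin order_trans)
  then have "Max (eigenvalues N) = Max (eigenvalues M)"
    using Max_mono[OF assms(1-3)] by simp
  moreover have "Min (eigenvalues M) \<le> Min (eigenvalues N)"
    using assms(4)[OF Min_in[OF assms(3) ne]] by (meson Min_le fin order_trans)
  then have "Min (eigenvalues N) = Min (eigenvalues M)"
    using Min_antimono[OF assms(1-3)] by simp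
  ultimately show ?thesis
    by (simp add: condition_number_def)
qed

text \<open>The lower bound does not depend on \<open>A\<close>: the mean block alone already contributes the spectrum
  of the inverse of \<open>Q\<close>.\<close>

lemma system_matrix_simultaneously_diagonalizable:
  fixes Q A :: "real^'d^'d"
  assumes Q: "Q \<in> sym_pos" and A: "A \<in> sym_pos" "simultaneously_diagonalizable A Q"
  shows "positive_spectrum (system_matrix Q 0 A)"
    and "condition_number (matrix_inv Q) \<le> condition_number (system_matrix Q 0 A)"
proof -
  from A(2) obtain P a q where P: "invertible (P :: real^'d^'d)"
    and a: "\<And>i. A *v column i P = a i *s column i P"
    and q: "\<And>i. Q *v column i P = q i *s column i P"
    by (rule simultaneously_diagonalizable_eigenbasis) blast
  note spec = system_matrix_spectrum[OF Q A(1) P q a]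
  show "positive_spectrum (system_matrix Q 0 A)"
    unfolding positive_spectrum_def spec(3) using spec(5) by blast
  have "1 / q i = zero_mean_eigenvalue q a (Inl i)" for i
    by (simp add: zero_mean_eigenvalue_def)
  then have "eigenvalues (matrix_inv Q) \<subseteq> eigenvalues (system_matrix Q 0 A)"
    unfolding spec(1,2) by auto
  then show "condition_number (matrix_inv Q) \<le> condition_number (system_matrix Q 0 A)"
    by (rule condition_number_mono) (use spec in auto)
qed

text \<open>For this \<open>A\<close> the eigenvalue of a pair of eigenvectors of \<open>Q\<close> is the arithmetic mean of the
  corresponding eigenvalues of the inverse of \<open>Q\<close>, so the covariance block does not widen the
  spectrum. That \<open>A\<close> competes at all needs \<open>Q\<close> to be diagonalizable, hence the spectral theorem.\<close>

lemma half_inverse_attains_bound: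
  fixes Q :: "real^'d^'d"
  assumes Q: "Q \<in> sym_pos"
  defines "A \<equiv> (1/2) *\<^sub>R matrix_inv Q"
  shows "A \<in> sym_pos" and "simultaneously_diagonalizable A Q"
    and "condition_number (system_matrix Q 0 A) = condition_number (matrix_inv Q)"
proof -
  show A: "A \<in> sym_pos"
    unfolding A_def by (rule sym_pos_scaleR[OF sym_pos_matrix_inv[OF Q]]) simp
  have "transpose Q = Q" using Q by (simp add: sym_pos_def)
  then obtain P q where P: "invertible (P :: real^'d^'d)"
    and q: "\<And>i. Q *v column i P = q i *s column i P"
    by (rule symmetric_matrix_eigenbasis) blast
  have qpos: "0 < q i" for i
    using sym_pos_eigenvalue_pos Q q column_invertible_nonzero[OF P] by blast
  define a where "a = (\<lambda>i. 1 / (2 * q i))"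
  have a: "A *v column i P = a i *s column i P" for i
    using matrix_inv_eigenvector[OF sym_pos_invertible[OF Q] q, of i] qpos[of i]
    by (simp add: A_def a_def vec_eq_iff flip: scaleR_matrix_vector_assoc)
  show "simultaneously_diagonalizable A Q"
    unfolding simultaneously_diagonalizable_def using P a q diagonal_iff_eigenbasis by blast
  note spec = system_matrix_spectrum[OF Q A P q a]
  have ev: "zero_mean_eigenvalue q a (Inl i) = 1 / q i"
     "zero_mean_eigenvalue q a (Inr (i, j)) = (1 / q i + 1 / q j) / 2" for i j
    using qpos[of i] qpos[of j] by (simp_all add: zero_mean_eigenvalue_def a_def field_simps)
  show "condition_number (system_matrix Q 0 A) = condition_number (matrix_inv Q)"
  proof (rule condition_number_sandwich)
    show "eigenvalues (matrix_inv Q) \<subseteq> eigenvalues (system_matrix Q 0 A)"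
      unfolding spec(1,2) by (auto simp flip: ev(1))
    fix l assume "l \<in> eigenvalues (system_matrix Q 0 A)"
    then obtain k where k: "l = zero_mean_eigenvalue q a k"
      unfolding spec(2) by blast
    have "\<exists>i j. 1 / q i \<le> l \<and> l \<le> 1 / q j"
    proof (cases k)
      case (Inl i)
      then show ?thesis using k by (auto simp: ev)
    next
      case (Inr ij)
      then obtain i j where "l = (1 / q i + 1 / q j) / 2"
        using k ev(2) by (cases ij) auto
      then have "1 / q i \<le> l \<and> l \<le> 1 / q j \<or> 1 / q j \<le> l \<and> l \<le> 1 / q i"
        by argo
      then show ?thesis by blast
    qed
    then show "\<exists>x\<in>eigenvalues (matrix_inv Q). \<exists>y\<in>eigenvalues (matrix_inv Q). x \<le> l \<and> l \<le> y"
      unfolding spec(1) by blast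
  qed (use spec in auto)
qed

section \<open>The spectrum of the system matrix in dimension one\<close>

text \<open>The characteristic equation over an arbitrary field, so that it serves the real and the complex
  spectrum alike. The index type is arbitrary because the system matrix in dimension one is
  indexed by a sum of one-element types.\<close>

lemma eigenvalues_two_dim:
  fixes M :: "'a::field^'n^'n"
  assumes ij: "UNIV = {i, j}" "i \<noteq> j"
  shows "eigenvalues M = {l. (l - M $ i $ i) * (l - M $ j $ j) = M $ i $ j * M $ j $ i}"
proof (intro set_eqI iffI)
  have all: "(\<forall>k. P k) \<longleftrightarrow> P i \<and> P j" for P
    using ij(1) by (metis UNIV_I insertE singletonD)
  have "sum f UNIV = f i + f j" for f :: "'n \<Rightarrow> 'a"
    using ij(2) by (subst ij(1)) simp
  then have mult: "(M *v v) $ k = M $ k $ i * v $ i + M $ k $ j * v $ j" for v k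
    by (simp add: matrix_vector_mult_def)
  {
    fix l assume "l \<in> eigenvalues M"
    then obtain v where v: "v \<noteq> 0" "M *v v = l *s v"
      by (auto simp: eigenvalues_def)
    then have e: "(l - M $ i $ i) * v $ i = M $ i $ j * v $ j" "(l - M $ j $ j) * v $ j = M $ j $ i * v $ i"
      by (simp_all add: vec_eq_iff all mult algebra_simps)
    have "((l - M $ i $ i) * (l - M $ j $ j) - M $ i $ j * M $ j $ i) * v $ i = 0"
         "((l - M $ i $ i) * (l - M $ j $ j) - M $ i $ j * M $ j $ i) * v $ j = 0"
      using e by algebra+
    then show "l \<in> {l. (l - M $ i $ i) * (l - M $ j $ j) = M $ i $ j * M $ j $ i}"
      using v(1) by (auto simp: vec_eq_iff all)
  next
    fix l assume "l \<in> {l. (l - M $ i $ i) * (l - M $ j $ j) = M $ i $ j * M $ j $ i}"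
    then have l: "(l - M $ i $ i) * (l - M $ j $ j) = M $ i $ j * M $ j $ i" by simp
    have ev: "l \<in> eigenvalues M" if "x \<noteq> 0 \<or> y \<noteq> 0"
      "M $ i $ i * x + M $ i $ j * y = l * x" "M $ j $ i * x + M $ j $ j * y = l * y" for x y
    proof -
      define v where "v = (\<chi> k. if k = i then x else y)"
      have "v \<noteq> 0" "M *v v = l *s v"
        using that ij(2) by (auto simp: v_def vec_eq_iff all mult)
      then show ?thesis by (auto simp: eigenvalues_def)
    qed
    \<comment> \<open>The generic eigenvector comes from the first row and degenerates to zero in the last two cases.\<close>
    consider "M $ i $ j \<noteq> 0 \<or> l \<noteq> M $ i $ i" | "M $ i $ j = 0" "l = M $ i $ i" "l \<noteq> M $ j $ j"
      | "M $ i $ j = 0" "l = M $ i $ i" "l = M $ j $ j" by blast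
    then show "l \<in> eigenvalues M"
    proof cases
      case 1
      with l show ?thesis
        by (intro ev[of "M $ i $ j" "l - M $ i $ i"]) (auto simp: algebra_simps)
    next
      case 2
      then show ?thesis
        by (intro ev[of "l - M $ j $ j" "M $ j $ i"]) (auto simp: algebra_simps)
    next
      case 3
      then show ?thesis
        by (intro ev[of 0 1]) auto
    qed
  }
qed

text \<open>Vieta: real roots with the right sum and product factor the characteristic polynomial over the
  complex numbers, too.\<close>

lemma of_real_quadratic_factor:
  fixes l :: "'f::{field,real_algebra_1}"
  assumes "u + w = k + p" "u * w = k * p - r"
  shows "(l - of_real k) * (l - of_real p) - of_real r = (l - of_real u) * (l - of_real w)"
proof -
  have "of_real u + of_real w = (of_real k + of_real p :: 'f)"
    "of_real u * of_real w = (of_real k * of_real p - of_real r :: 'f)"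
    using assms by (metis of_real_add, metis of_real_mult of_real_diff)
  then show ?thesis by algebra
qed

lemma real_spectrum_two_dim:
  fixes M :: "real^'n^'n"
  assumes ij: "UNIV = {i, j}" "i \<noteq> j"
    and sum: "u + w = M $ i $ i + M $ j $ j"
    and prod: "u * w = M $ i $ i * M $ j $ j - M $ i $ j * M $ j $ i"
  shows "eigenvalues M = {u, w}" and "complex_eigenvalues M = complex_of_real ` {u, w}"
proof -
  have "(l - M $ i $ i) * (l - M $ j $ j) = M $ i $ j * M $ j $ i \<longleftrightarrow> l = u \<or> l = w" for l
    using of_real_quadratic_factor[OF sum prod, of l] by auto
  then show "eigenvalues M = {u, w}"
    by (auto simp: eigenvalues_two_dim[OF ij])
  have "(l - of_real (M $ i $ i)) * (l - of_real (M $ j $ j)) = of_real (M $ i $ j) * of_real (M $ j $ i)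
      \<longleftrightarrow> l = of_real u \<or> l = of_real w" for l :: complex
    using of_real_quadratic_factor[OF sum prod, of l] by auto
  then show "complex_eigenvalues M = complex_of_real ` {u, w}"
    by (auto simp: eigenvalues_two_dim[OF ij])
qed

lemma matrix_inv_mat:
  assumes "q \<noteq> (0::real)"
  shows "matrix_inv (mat q :: real^'n^'n) = mat (1 / q)"
proof -
  have "(mat q ** mat (1 / q)) $ i $ j = (mat 1 :: real^'n^'n) $ i $ j" for i j :: 'n
  proof -
    have "(mat q ** mat (1 / q)) $ i $ j
        = (\<Sum>k\<in>UNIV. if k = i then (mat 1 :: real^'n^'n) $ i $ j else 0)"
      unfolding matrix_matrix_mult_def vec_lambda_beta
      by (rule sum.cong) (use assms in \<open>auto simp: mat_def\<close>)
    then show ?thesis by simp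
  qed
  then have "mat q ** mat (1 / q) = (mat 1 :: real^'n^'n)"
    by (simp add: vec_eq_iff)
  then show ?thesis
    by (metis invertible_right_inverse matrix_inv_invertible(2) matrix_mul_assoc matrix_mul_lid matrix_mul_rid)
qed

lemma system_matrix_dim_one_entries:
  fixes q b a :: real
  assumes "q \<noteq> 0"
  defines "M \<equiv> system_matrix (mat q :: real^1^1) (vec b) (mat a)"
  shows "M $ Inl 1 $ Inl 1 = (a * b\<^sup>2 + 1) / q" "M $ Inl 1 $ Inr (1, 1) = a * b / q"
    "M $ Inr (1, 1) $ Inl 1 = 2 * (a * b)" "M $ Inr (1, 1) $ Inr (1, 1) = 2 * a"
  using assms(1) unfolding M_def system_matrix_def matrix_inv_mat[OF assms(1)]
  by (simp_all add: block_matrix_def stack_def stein_kernel_def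
      row_kron_def col_kron_sum_def kron_sum_def kron_def rowvector_def columnvector_def
      matrix_vector_mult_def vector_matrix_mult_def matrix_matrix_mult_def mat_def inner_vec_def
      power2_eq_square field_simps)

text \<open>Although the matrix is not symmetric, its two off-diagonal entries have a nonnegative product.
  Hence the discriminant of the characteristic polynomial is nonnegative and the eigenvalues are
  real; trace and determinant are positive, and so are they.\<close>

lemma system_matrix_dim_one_spectrum:
  fixes q b a :: real
  assumes q: "0 < q" and a: "0 < a"
  defines "M \<equiv> system_matrix (mat q :: real^1^1) (vec b) (mat a)"
  obtains u w where "0 < u" "u \<le> w" "u + w = (a * b\<^sup>2 + 1) / q + 2 * a" "u * w = 2 * a / q"
    "eigenvalues M = {u, w}" "complex_eigenvalues M = complex_of_real ` {u, w}"
proof -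
  define k s where "k = (a * b\<^sup>2 + 1) / q" and "s = k + 2 * a"
  have det: "k * (2 * a) - a * b / q * (2 * (a * b)) = 2 * a / q"
    using q by (simp add: k_def field_simps power2_eq_square)
  define D where "D = (k - 2 * a)\<^sup>2 + 8 * a\<^sup>2 * b\<^sup>2 / q"
  have D: "0 \<le> D"
    using q by (simp add: D_def)
  have "s\<^sup>2 = (k - 2 * a)\<^sup>2 + 4 * (k * (2 * a))"
    by (simp add: s_def power2_eq_square algebra_simps)
  also have "k * (2 * a) = 2 * a / q + a * b / q * (2 * (a * b))"
    using det by simp
  finally have Ds: "D = s\<^sup>2 - 8 * a / q"
    by (simp add: D_def power2_eq_square algebra_simps)
  define u w where "u = (s - sqrt D) / 2" and "w = (s + sqrt D) / 2"
  have "0 < k"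
    using q a by (simp add: k_def add_nonneg_pos)
  then have "0 < s"
    using a by (simp add: s_def)
  have sum: "u + w = k + 2 * a"
    by (simp add: u_def w_def s_def field_simps)
  have "u * w = (s\<^sup>2 - (sqrt D)\<^sup>2) / 4"
    by (simp add: u_def w_def field_simps power2_eq_square)
  then have prod: "u * w = 2 * a / q"
    using D by (simp add: Ds)
  have "0 < w"
    using \<open>0 < s\<close> D by (simp add: w_def add_pos_nonneg)
  moreover have "0 < u * w"
    using prod q a by simp
  ultimately have "0 < u"
    by (metis zero_less_mult_pos2)
  have ij: "(UNIV :: (1 + 1 \<times> 1) set) = {Inl 1, Inr (1, 1)}"
    by (auto simp flip: UNIV_Plus_UNIV simp: UNIV_1)
  note entries = system_matrix_dim_one_entries[of q b a, folded M_def]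
  have "u + w = M $ Inl 1 $ Inl 1 + M $ Inr (1, 1) $ Inr (1, 1)"
    "u * w = M $ Inl 1 $ Inl 1 * M $ Inr (1, 1) $ Inr (1, 1) - M $ Inl 1 $ Inr (1, 1) * M $ Inr (1, 1) $ Inl 1"
    using q entries sum prod det by (simp_all add: k_def)
  note spec = real_spectrum_two_dim[OF ij _ this]
  show ?thesis
    using that[of u w] \<open>0 < u\<close> sum prod spec D by (simp add: k_def u_def w_def)
qed

section \<open>Optimal scaling, step size and decay in dimension one\<close>

lemma add_inverse_less_iff:
  fixes x y :: real
  assumes "1 \<le> x" "1 \<le> y"
  shows "x + 1 / x < y + 1 / y \<longleftrightarrow> x < y"
proof -
  have *: "x + 1 / x < y + 1 / y" if "1 \<le> x" "x < y" for x y :: real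
  proof -
    have "1 * 1 < y * x"
      using that by (intro mult_less_le_imp_less) auto
    then have "0 < (y - x) * (1 - 1 / (x * y))"
      using that by (simp add: mult.commute)
    then show ?thesis
      using that by (simp add: field_simps)
  qed
  show ?thesis
    using *[of x y] *[of y x] assms by (cases x y rule: linorder_cases) auto
qed

text \<open>The sum \<open>\<kappa> + 1 / \<kappa>\<close> equals the squared trace divided by the determinant, minus two. This is a
  rational function of \<open>a\<close> that avoids the square roots in the eigenvalues, and completing
  the square isolates its dependence on \<open>a\<close> in a term that vanishes exactly at \<open>1 / c\<close>.\<close>

lemma condition_number_dim_one:
  fixes q b a :: real
  assumes q: "0 < q" and a: "0 < a"
  defines "\<kappa> \<equiv> condition_number (system_matrix (mat q :: real^1^1) (vec b) (mat a))"
    and "c \<equiv> 2 * q + b\<^sup>2"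
  shows "1 \<le> \<kappa>" and "\<kappa> + 1 / \<kappa> = (a * c - 1)\<^sup>2 / (2 * a * q) + (2 * c / q - 2)"
proof -
  obtain u w where uw: "0 < u" "u \<le> w" "u + w = (a * b\<^sup>2 + 1) / q + 2 * a" "u * w = 2 * a / q"
    and spec: "eigenvalues (system_matrix (mat q :: real^1^1) (vec b) (mat a)) = {u, w}"
    using system_matrix_dim_one_spectrum[OF q a, of b] by metis
  have \<kappa>: "\<kappa> = w / u"
    using uw by (simp add: \<kappa>_def condition_number_def spec max_def min_def)
  then show "1 \<le> \<kappa>"
    using uw by simp
  have "\<kappa> + 1 / \<kappa> = (u + w)\<^sup>2 / (u * w) - 2"
    using uw(1,2) by (simp add: \<kappa> field_simps power2_eq_square)
  also have "u + w = (a * c + 1) / q"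
    using q by (simp add: uw(3) c_def field_simps)
  also have "((a * c + 1) / q)\<^sup>2 / (u * w) - 2 = (a * c - 1)\<^sup>2 / (2 * a * q) + (2 * c / q - 2)"
    using q a by (simp add: uw(4) field_simps power2_eq_square)
  finally show "\<kappa> + 1 / \<kappa> = (a * c - 1)\<^sup>2 / (2 * a * q) + (2 * c / q - 2)" .
qed

text \<open>Minimizing \<open>\<kappa>\<close> and minimizing \<open>\<kappa> + 1 / \<kappa>\<close> are the same because \<open>\<kappa> \<ge> 1\<close>.\<close>

lemma condition_number_dim_one_optimal:
  fixes q b :: real
  assumes q: "0 < q"
  shows "is_arg_min (\<lambda>a. condition_number (system_matrix (mat q :: real^1^1) (vec b) (mat a)))
      (\<lambda>a. 0 < a) a \<longleftrightarrow> a = 1 / (2 * q + b\<^sup>2)"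
proof -
  define c where "c = 2 * q + b\<^sup>2"
  define \<kappa> where "\<kappa> = (\<lambda>a. condition_number (system_matrix (mat q :: real^1^1) (vec b) (mat a)))"
  have c: "0 < c"
    using q by (simp add: c_def add_pos_nonneg)
  define e where "e = (\<lambda>a. (a * c - 1)\<^sup>2 / (2 * a * q))"
  have less: "\<kappa> x < \<kappa> y \<longleftrightarrow> e x < e y" if "0 < x" "0 < y" for x y
    using add_inverse_less_iff[of "\<kappa> x" "\<kappa> y"] condition_number_dim_one[OF q that(1), of b]
      condition_number_dim_one[OF q that(2), of b]
    by (simp add: \<kappa>_def c_def e_def)
  have e: "0 \<le> e x" "e x = 0 \<longleftrightarrow> x = 1 / c" if "0 < x" for x
    using that q c by (auto simp: e_def field_simps)
  have "is_arg_min \<kappa> (\<lambda>a. 0 < a) a \<longleftrightarrow> 0 < a \<and> (\<forall>y>0. e a \<le> e y)"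
    unfolding is_arg_min_def using less by (metis not_less)
  also have "\<dots> \<longleftrightarrow> a = 1 / c"
  proof
    assume "0 < a \<and> (\<forall>y>0. e a \<le> e y)"
    then show "a = 1 / c"
      using e[of a] e[of "1 / c"] c by (metis antisym divide_pos_pos zero_less_one)
  next
    assume a: "a = 1 / c"
    then have "e a = 0" "0 < a"
      using e(2)[of a] c by simp_all
    then show "0 < a \<and> (\<forall>y>0. e a \<le> e y)"
      using e(1) by simp
  qed
  finally show ?thesis
    by (simp add: \<kappa>_def c_def)
qed

text \<open>At the optimum both eigenvalues are contracted equally. A smaller step worsens the factor of
  the smaller eigenvalue, a larger step that of the larger one.\<close>

lemma optimal_step_size_two_eigenvalues:
  fixes M :: "real^'n^'n"
  assumes spec: "complex_eigenvalues M = complex_of_real ` {u, w}" and u: "0 < u" "u \<le> w"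
  shows "optimal_step_size M h \<longleftrightarrow> h = 2 / (u + w)"
proof -
  define c where "c = contraction_factor M"
  define h0 where "h0 = 2 / (u + w)"
  have h0: "0 < h0" using u by (simp add: h0_def)
  have "cmod (1 - complex_of_real h * complex_of_real x) = \<bar>1 - h * x\<bar>" for h x
    by (metis norm_of_real of_real_1 of_real_diff of_real_mult)
  then have c: "c h = max \<bar>1 - h * u\<bar> \<bar>1 - h * w\<bar>" for h
    by (simp add: c_def contraction_factor_def spec)
  have e: "1 - h0 * u = (w - u) / (u + w)" "h0 * w - 1 = (w - u) / (u + w)"
    using u by (simp_all add: h0_def field_simps)
  have c0: "c h0 = 1 - h0 * u" "c h0 = h0 * w - 1"
  proof -
    have "0 \<le> (w - u) / (u + w)"
      using u by simp
    then show "c h0 = 1 - h0 * u" "c h0 = h0 * w - 1"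
      using e unfolding c by linarith+
  qed
  have "c h0 < c h" if "h \<noteq> h0" for h
  proof (cases "h < h0")
    case True
    then have "1 - h0 * u < 1 - h * u"
      using u by simp
    then show ?thesis
      using c0(1) c[of h] by linarith
  next
    case False
    with that have "h0 * w < h * w"
      using u by simp
    then have "h0 * w - 1 < h * w - 1"
      by simp
    then show ?thesis
      using c0(2) c[of h] by linarith
  qed
  then show ?thesis
    unfolding optimal_step_size_def is_arg_min_def c_def[symmetric] h0_def[symmetric]
    using h0 by (metis less_asym)
qed

text \<open>Multiplication by the integrating factor makes \<open>z\<close> constant.\<close>

lemma exponential_decay:
  fixes z :: "real \<Rightarrow> 'a::real_normed_vector"
  assumes z: "\<And>t. 0 \<le> t \<Longrightarrow> (z has_vector_derivative - (r *\<^sub>R z t)) (at t within {0..})" and t: "0 \<le> t"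
  shows "z t = exp (- (r * t)) *\<^sub>R z 0"
proof -
  define y where "y = (\<lambda>t. exp (r * t) *\<^sub>R z t)"
  have "(y has_vector_derivative 0) (at t within {0..})" if "t \<in> {0..}" for t
  proof -
    have "((\<lambda>t. exp (r * t)) has_real_derivative exp (r * t) * r) (at t within {0..})"
      by (auto intro!: derivative_eq_intros)
    then show ?thesis
      unfolding y_def using has_vector_derivative_scaleR[OF _ z, of "\<lambda>t. exp (r * t)" "exp (r * t) * r" t] that
      by simp
  qed
  then obtain k where k: "\<And>t. t \<in> {0..} \<Longrightarrow> y t = k"
    using has_vector_derivative_zero_constant[of "{0::real..}" y] by auto
  have "exp (r * t) *\<^sub>R z t = z 0"
    using k[of t] k[of 0] t by (simp add: y_def)
  then have "exp (- (r * t)) *\<^sub>R exp (r * t) *\<^sub>R z t = exp (- (r * t)) *\<^sub>R z 0"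
    by simp
  then show ?thesis
    by (simp flip: exp_add)
qed

text \<open>With zero target mean the optimal scaling is \<open>1 / (2 * q)\<close>, and mean and covariance decay at the
  same rate, without coupling.\<close>

lemma stein_linearization_dim_one:
  assumes "q \<noteq> 0"
  shows "stein_linearization (mat q :: real^1^1) 0 (mat (1 / (2 * q))) z = - ((1 / q) *\<^sub>R z)"
  using assms
  unfolding stein_linearization_def matrix_inv_mat[OF assms]
  by (cases z) (simp add: stein_kernel_def sym_part_def outer_def vec_eq_iff
    matrix_vector_mult_def matrix_matrix_mult_def mat_def transpose_def forall_1)

theorem lemma5p2:
  shows
    "(\<forall>q::real. \<forall>b::real. 0 < q \<longrightarrow>
        (let B = (\<lambda>a. system_matrix (mat q :: real^1^1) (vec b) (mat a));
             a_opt = 1 / (2 * q + b\<^sup>2)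
         in (\<forall>a>0. positive_spectrum (B a))
          \<and> (\<forall>a. is_arg_min (\<lambda>a. condition_number (B a)) (\<lambda>a. 0 < a) a \<longleftrightarrow> a = a_opt)
          \<and> (\<forall>h. optimal_step_size (B a_opt) h \<longleftrightarrow> h = q)
          \<and> (b = 0 \<longrightarrow>
               (\<forall>\<mu> \<Sigma>. linearized_solution (mat q :: real^1^1) (vec b) (mat a_opt) \<mu> \<Sigma> \<longrightarrow>
                  (\<forall>t\<ge>0. norm (\<mu> t, \<Sigma> t) \<le> exp (- (1 / q) * t) * norm (\<mu> 0, \<Sigma> 0))))))
   \<and> (\<forall>Q\<in>(sym_pos :: (real^'d^'d) set).
        (\<forall>A\<in>sym_pos. simultaneously_diagonalizable A Q \<longrightarrow> positive_spectrum (system_matrix Q 0 A))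
      \<and> is_arg_min (\<lambda>A. condition_number (system_matrix Q 0 A))
          (\<lambda>A. A \<in> sym_pos \<and> simultaneously_diagonalizable A Q)
          ((1 / 2) *\<^sub>R matrix_inv Q))"
proof (intro conjI allI impI ballI)
  fix q b :: real assume q: "0 < q"
  let ?B = "\<lambda>a. system_matrix (mat q :: real^1^1) (vec b) (mat a)"
  define a_opt where "a_opt = 1 / (2 * q + b\<^sup>2)"
  have a_opt: "0 < a_opt"
    using q by (simp add: a_opt_def add_pos_nonneg)
  have pos: "positive_spectrum (?B a)" if a: "0 < a" for a
  proof -
    obtain u w where "0 < u" "u \<le> w" "complex_eigenvalues (?B a) = complex_of_real ` {u, w}"
      using system_matrix_dim_one_spectrum[OF q a, of b] .
    then show ?thesis
      unfolding positive_spectrum_def by auto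
  qed
  have step: "optimal_step_size (?B a_opt) h \<longleftrightarrow> h = q" for h
  proof -
    obtain u w where uw: "0 < u" "u \<le> w" "u + w = (a_opt * b\<^sup>2 + 1) / q + 2 * a_opt"
      and spec: "complex_eigenvalues (?B a_opt) = complex_of_real ` {u, w}"
      using system_matrix_dim_one_spectrum[OF q a_opt, of b] .
    have "a_opt * (2 * q + b\<^sup>2) = 1"
      using a_opt by (simp add: a_opt_def)
    then have "u + w = 2 / q"
      using q by (simp add: uw(3) field_simps)
    then show ?thesis
      using optimal_step_size_two_eigenvalues[OF spec uw(1,2)] by simp
  qed
  have decay: "norm (\<mu> t, \<Sigma> t) \<le> exp (- (1 / q) * t) * norm (\<mu> 0, \<Sigma> 0)"
    if "b = 0" "linearized_solution (mat q :: real^1^1) (vec b) (mat a_opt) \<mu> \<Sigma>" "0 \<le> t" for \<mu> \<Sigma> t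
  proof -
    have lin: "stein_linearization (mat q :: real^1^1) (vec b) (mat a_opt) z = - ((1 / q) *\<^sub>R z)" for z
      using stein_linearization_dim_one[of q z] q \<open>b = 0\<close> by (simp add: a_opt_def vec_0)
    have "((\<lambda>s. (\<mu> s, \<Sigma> s)) has_vector_derivative - ((1 / q) *\<^sub>R (\<mu> t, \<Sigma> t))) (at t within {0..})"
      if "0 \<le> t" for t
      using \<open>linearized_solution _ _ _ _ _\<close> that unfolding linearized_solution_def lin by blast
    from exponential_decay[OF this \<open>0 \<le> t\<close>] show ?thesis
      by (simp only: norm_scaleR abs_exp_cancel mult_minus_left order_refl)
  qed
  show "let B = ?B; a_opt = 1 / (2 * q + b\<^sup>2)
         in (\<forall>a>0. positive_spectrum (B a))
          \<and> (\<forall>a. is_arg_min (\<lambda>a. condition_number (B a)) (\<lambda>a. 0 < a) a \<longleftrightarrow> a = a_opt)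
          \<and> (\<forall>h. optimal_step_size (B a_opt) h \<longleftrightarrow> h = q)
          \<and> (b = 0 \<longrightarrow>
               (\<forall>\<mu> \<Sigma>. linearized_solution (mat q :: real^1^1) (vec b) (mat a_opt) \<mu> \<Sigma> \<longrightarrow>
                  (\<forall>t\<ge>0. norm (\<mu> t, \<Sigma> t) \<le> exp (- (1 / q) * t) * norm (\<mu> 0, \<Sigma> 0))))"
    unfolding Let_def a_opt_def[symmetric]
    using pos condition_number_dim_one_optimal[OF q, of b] step decay by (simp add: a_opt_def)
next
  fix Q A :: "real^'d^'d" assume "Q \<in> sym_pos" "A \<in> sym_pos" "simultaneously_diagonalizable A Q"
  then show "positive_spectrum (system_matrix Q 0 A)"
    by (rule system_matrix_simultaneously_diagonalizable)
next
  fix Q :: "real^'d^'d" assume "Q \<in> sym_pos"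
  then show "is_arg_min (\<lambda>A. condition_number (system_matrix Q 0 A))
      (\<lambda>A. A \<in> sym_pos \<and> simultaneously_diagonalizable A Q) ((1 / 2) *\<^sub>R matrix_inv Q)"
    using half_inverse_attains_bound[of Q] system_matrix_simultaneously_diagonalizable(2)[of Q]
    by (auto simp: is_arg_min_def not_less)
qed

end
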